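(* Let $\mu_1,\mu_2>0$, $q>0$, and let $a>1$, $b>1$, $c\ge0$ satisfy $(a-1)(b-1)\ge(c-1)^2$. Suppose that $Q_a\ge q$ and $Q_b\ge q$. Then an optimal distribution for the problem $$v_P(q;\theta)=\sup_{\mathbb P\in\mathcal F(\theta)}\mathbb E_{\mathbb P}[(X_1+X_2-q)_+]$$ is characterized as follows. (i) If $b>c$, the distribution taking the value $(0,0)$ with probability $p_1=\frac{(a-1)(b-1)-(c-1)^2}{ab-c^2}$, the value $\left(\frac{ab-c^2}{b-c}\mu_1,0\right)$ with probability $p_2=\frac{(b-c)^2}{(ab-c^2)b}$, and the value $(c\mu_1,b\mu_2)$ with probability $p_3=\frac1b$ is optimal. (ii) If $a>c$, the distribution taking the value $(0,0)$ with probability $p_1=\frac{(a-1)(b-1)-(c-1)^2}{ab-c^2}$, the value $\left(0,\frac{ab-c^2}{a-c}\mu_2\right)$ with probability $p_2=\frac{(a-c)^2}{(ab-c^2)a}$, and the value $(a\mu_1,c\mu_2)$ with probability $p_3=\frac1a$ is optimal. In both cases the optimal value is $v_P(q;\theta)=\mu_1+\mu_2-q\cdot\frac{a+b-2c}{ab-c^2}$.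
   Context: $(t)_+=\max\{t,0\}$. $\theta=(\mu_1,\mu_2,a\mu_1^2,b\mu_2^2,c\mu_1\mu_2)$, and $\mathcal F(\theta)$ is the set of all probability distributions $\mathbb P$ of a random vector $(X_1,X_2)$ supported on $\mathbb R_+^2=[0,\infty)^2$ such that $\mathbb E_{\mathbb P}[X_1]=\mu_1$, $\mathbb E_{\mathbb P}[X_2]=\mu_2$, $\mathbb E_{\mathbb P}[X_1^2]=a\mu_1^2$, $\mathbb E_{\mathbb P}[X_2^2]=b\mu_2^2$, $\mathbb E_{\mathbb P}[X_1X_2]=c\mu_1\mu_2$. "Optimal distribution" means a distribution belonging to $\mathcal F(\theta)$ at which the supremum is attained. Notation: $$Q_a=\sqrt{q^2-2q\tfrac{a-c}{a-1}\mu_2+\tfrac{ab-c^2}{a-1}\mu_2^2},\quad Q_b=\sqrt{q^2-2q\tfrac{b-c}{b-1}\mu_1+\tfrac{ab-c^2}{b-1}\mu_1^2}.$$ *)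

theory Defs
  imports "HOL-Probability.Probability"
begin

text \<open>
  A distribution of a random vector \<open>(X\<^sub>1, X\<^sub>2)\<close> is a Borel probability measure on
  \<open>real \<times> real\<close>, with \<open>X\<^sub>1 = fst\<close> and \<open>X\<^sub>2 = snd\<close>. The arguments of \<open>moment_class\<close> are
  the five components of \<open>\<theta>\<close>: \<open>E[X\<^sub>1]\<close>, \<open>E[X\<^sub>2]\<close>, \<open>E[X\<^sub>1\<^sup>2]\<close>, \<open>E[X\<^sub>2\<^sup>2]\<close>, \<open>E[X\<^sub>1 X\<^sub>2]\<close>.
  Using \<open>has_bochner_integral\<close> requires each moment to exist, rather than to take the
  default value \<open>0\<close> of the integral of a non-integrable function.
\<close>

definition moment_class ::
  "real \<Rightarrow> real \<Rightarrow> real \<Rightarrow> real \<Rightarrow> real \<Rightarrow> (real \<times> real) measure set" where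
  "moment_class m1 m2 s1 s2 s12 =
    {P. prob_space P \<and> sets P = sets borel \<and>
        (AE x in P. 0 \<le> fst x \<and> 0 \<le> snd x) \<and>
        has_bochner_integral P (\<lambda>x. fst x) m1 \<and>
        has_bochner_integral P (\<lambda>x. snd x) m2 \<and>
        has_bochner_integral P (\<lambda>x. (fst x)\<^sup>2) s1 \<and>
        has_bochner_integral P (\<lambda>x. (snd x)\<^sup>2) s2 \<and>
        has_bochner_integral P (\<lambda>x. fst x * snd x) s12}"

definition expected_excess :: "real \<Rightarrow> (real \<times> real) measure \<Rightarrow> real" where
  "expected_excess q P = (\<integral>x. max (fst x + snd x - q) 0 \<partial>P)"

text \<open>
  The supremum is taken in \<open>ereal\<close>, so that it is meaningful without assuming boundedness
  or nonemptiness. On \<open>moment_class\<close> the integrand of \<open>expected_excess\<close> is integrable.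
\<close>

definition v_P :: "real \<Rightarrow> (real \<times> real) measure set \<Rightarrow> ereal" where
  "v_P q F = (SUP P\<in>F. ereal (expected_excess q P))"

definition optimal_distribution ::
  "real \<Rightarrow> (real \<times> real) measure set \<Rightarrow> (real \<times> real) measure \<Rightarrow> bool" where
  "optimal_distribution q F P \<longleftrightarrow> P \<in> F \<and> ereal (expected_excess q P) = v_P q F"

text \<open>
  The law taking value \<open>x\<close> with probability \<open>p\<close> for each entry \<open>(x, p)\<close> of the list.
  \<open>measure_pmf\<close> lives on the full power set; \<open>distr\<close> moves it to the Borel sets.
\<close>

definition discrete_law :: "((real \<times> real) \<times> real) list \<Rightarrow> (real \<times> real) measure" where
  "discrete_law xs = distr (measure_pmf (pmf_of_list xs)) borel id"

definition Q_a :: "real \<Rightarrow> real \<Rightarrow> real \<Rightarrow> real \<Rightarrow> real \<Rightarrow> real" where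
  "Q_a q \<mu>2 a b c =
    sqrt (q\<^sup>2 - 2 * q * ((a - c) / (a - 1)) * \<mu>2 + (a * b - c\<^sup>2) / (a - 1) * \<mu>2\<^sup>2)"

definition Q_b :: "real \<Rightarrow> real \<Rightarrow> real \<Rightarrow> real \<Rightarrow> real \<Rightarrow> real" where
  "Q_b q \<mu>1 a b c =
    sqrt (q\<^sup>2 - 2 * q * ((b - c) / (b - 1)) * \<mu>1 + (a * b - c\<^sup>2) / (b - 1) * \<mu>1\<^sup>2)"

end

theory Submission imports Defs begin

text \<open>
  Put \<open>D = a b - c\<^sup>2\<close> and \<open>\<ell>(x) = \<alpha> x\<^sub>1 + \<beta> x\<^sub>2\<close> with \<open>\<alpha> = (b - c) / (D \<mu>\<^sub>1)\<close> and
  \<open>\<beta> = (a - c) / (D \<mu>\<^sub>2)\<close>; this is the projection of the constant \<open>1\<close> onto the span of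
  \<open>X\<^sub>1, X\<^sub>2\<close> in \<open>L\<^sup>2\<close>. Squaring, \<open>Q\<^sub>b \<ge> q\<close> and \<open>Q\<^sub>a \<ge> q\<close> say precisely that
  \<open>2 q \<alpha> \<le> 1\<close> and \<open>2 q \<beta> \<le> 1\<close>. These make the quadratic \<open>x\<^sub>1 + x\<^sub>2 - q + q (1 - \<ell>(x))\<^sup>2\<close> a
  majorant of the excess on the quadrant, and its expectation is determined by the moments.
  The two three-point laws live where the majorant is tight: at the origin, and on the
  line \<open>\<ell> = 1\<close> within the half plane \<open>x\<^sub>1 + x\<^sub>2 \<ge> q\<close>.
\<close>

section \<open>Expectations under finitely supported laws\<close>

lemma sum_filter_weights:
  fixes f :: "'a \<Rightarrow> real"
  assumes "finite A" and "fst ` set xs \<subseteq> A"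
  shows "(\<Sum>x\<in>A. f x * sum_list (map snd (filter (\<lambda>z. fst z = x) xs))) =
         (\<Sum>(x, p)\<leftarrow>xs. p * f x)"
  using assms(2)
proof (induction xs)
  case (Cons z xs)
  have "(\<Sum>x\<in>A. f x * sum_list (map snd (filter (\<lambda>w. fst w = x) (z # xs)))) =
        (\<Sum>x\<in>A. (if fst z = x then snd z * f x else 0) +
           f x * sum_list (map snd (filter (\<lambda>w. fst w = x) xs)))"
    by (intro sum.cong) (auto simp: algebra_simps)
  also have "\<dots> = snd z * f (fst z) + (\<Sum>(x, p)\<leftarrow>xs. p * f x)"
    using Cons assms(1) by (simp add: sum.distrib)
  finally show ?case by (simp add: case_prod_unfold)
qed simp

lemma prob_space_discrete_law: "prob_space (discrete_law xs)"
  unfolding discrete_law_def by (intro measure_pmf.prob_space_distr) simp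

lemma sets_discrete_law [simp, measurable_cong]: "sets (discrete_law xs) = sets borel"
  unfolding discrete_law_def by simp

text \<open>Finite support makes every function integrable for the \<open>pmf\<close>, and
  measurability of \<open>f\<close> carries this over to the Borel sets. \<open>pmf_of_list\<close>
  adds up the weights of equal points; regrouping them by \<open>sum_filter_weights\<close> gives a
  sum over the list that is correct even when entries coincide.\<close>

lemma has_bochner_integral_discrete_law:
  fixes f :: "real \<times> real \<Rightarrow> real"
  assumes "pmf_of_list_wf xs" and f: "f \<in> borel_measurable borel"
  shows "has_bochner_integral (discrete_law xs) f (\<Sum>(x, p)\<leftarrow>xs. p * f x)"
proof -
  have "integral\<^sup>L (measure_pmf (pmf_of_list xs)) f =
        (\<Sum>x\<in>fst ` set xs. f x * pmf (pmf_of_list xs) x)"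
    using set_pmf_of_list[OF assms(1)] by (intro integral_measure_pmf_real) auto
  also have "\<dots> = (\<Sum>(x, p)\<leftarrow>xs. p * f x)"
    by (simp add: pmf_pmf_of_list[OF assms(1)] sum_filter_weights)
  finally have "has_bochner_integral (measure_pmf (pmf_of_list xs)) f (\<Sum>(x, p)\<leftarrow>xs. p * f x)"
    by (simp add: has_bochner_integral_iff
        integrable_measure_pmf_finite[OF finite_set_pmf_of_list[OF assms(1)]])
  then show ?thesis
    unfolding discrete_law_def using f
    by (simp add: has_bochner_integral_iff integrable_distr_eq integral_distr)
qed

lemma borel_measurable_fst_snd [measurable]:
  "(fst :: real \<times> real \<Rightarrow> real) \<in> borel_measurable borel"
  "(snd :: real \<times> real \<Rightarrow> real) \<in> borel_measurable borel"
  by (intro borel_measurable_continuous_onI continuous_intros)+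

lemma AE_discrete_law:
  assumes "pmf_of_list_wf xs" and "\<And>x. x \<in> fst ` set xs \<Longrightarrow> Q x"
    and "Measurable.pred borel Q"
  shows "AE x in discrete_law xs. Q x"
  unfolding discrete_law_def
  using assms set_pmf_of_list[OF assms(1)]
  by (subst AE_distr_iff) (auto simp: AE_measure_pmf_iff pred_def subset_iff)

text \<open>The atom at the origin adds nothing to any of the five moments. Its weight
  \<open>p\<close> enters only through the total mass and absorbs the probability left over by the
  other two atoms.\<close>

lemma three_point_moment_class:
  fixes p r s u1 u2 w1 w2 :: real
  defines "xs \<equiv> [((0, 0), p), ((u1, u2), r), ((w1, w2), s)]"
  assumes "p \<ge> 0" "r \<ge> 0" "s \<ge> 0" "p + r + s = 1"
    and "u1 \<ge> 0" "u2 \<ge> 0" "w1 \<ge> 0" "w2 \<ge> 0"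
    and "r * u1 + s * w1 = m1" "r * u2 + s * w2 = m2"
    and "r * u1\<^sup>2 + s * w1\<^sup>2 = s1" "r * u2\<^sup>2 + s * w2\<^sup>2 = s2"
    and "r * (u1 * u2) + s * (w1 * w2) = s12"
  shows "discrete_law xs \<in> moment_class m1 m2 s1 s2 s12"
proof -
  have wf: "pmf_of_list_wf xs"
    using assms by (auto simp: pmf_of_list_wf_def)
  note int = has_bochner_integral_discrete_law[OF wf]
  have "AE x in discrete_law xs. 0 \<le> fst x \<and> 0 \<le> snd x"
    by (rule AE_discrete_law[OF wf]) (use assms in \<open>auto, measurable\<close>)
  moreover have "has_bochner_integral (discrete_law xs) fst m1"
    using int[of fst] assms by simp
  moreover have "has_bochner_integral (discrete_law xs) snd m2"
    using int[of snd] assms by simp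
  moreover have "has_bochner_integral (discrete_law xs) (\<lambda>x. (fst x)\<^sup>2) s1"
    using int[of "\<lambda>x. (fst x)\<^sup>2"] assms by simp
  moreover have "has_bochner_integral (discrete_law xs) (\<lambda>x. (snd x)\<^sup>2) s2"
    using int[of "\<lambda>x. (snd x)\<^sup>2"] assms by simp
  moreover have "has_bochner_integral (discrete_law xs) (\<lambda>x. fst x * snd x) s12"
    using int[of "\<lambda>x. fst x * snd x"] assms by simp
  ultimately show ?thesis
    unfolding moment_class_def using prob_space_discrete_law by simp
qed

text \<open>The positive part vanishes at the origin and is inactive at the other two atoms, so the
  excess is affine there and only their joint mass \<open>r + s\<close> multiplies
  \<open>q\<close>.\<close>

lemma three_point_expected_excess:
  fixes p r s u1 u2 w1 w2 q :: real
  assumes "p \<ge> 0" "r \<ge> 0" "s \<ge> 0" "p + r + s = 1"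
    and "q \<ge> 0" "u1 + u2 \<ge> q" "w1 + w2 \<ge> q"
  shows "expected_excess q (discrete_law [((0, 0), p), ((u1, u2), r), ((w1, w2), s)]) =
         (r * u1 + s * w1) + (r * u2 + s * w2) - q * (r + s)"
proof -
  have wf: "pmf_of_list_wf [((0, 0), p), ((u1, u2), r), ((w1, w2), s)]"
    using assms by (auto simp: pmf_of_list_wf_def)
  have "(\<lambda>x :: real \<times> real. max (fst x + snd x - q) 0) \<in> borel_measurable borel"
    by measurable
  from has_bochner_integral_integral_eq[OF has_bochner_integral_discrete_law[OF wf this]]
  show ?thesis
    unfolding expected_excess_def using assms by (simp add: max_absorb1 max_absorb2 algebra_simps)
qed

section \<open>Upper bound by a quadratic majorant\<close>

lemma excess_le_quadratic:
  fixes q \<alpha> \<beta> x y :: real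
  assumes "q \<ge> 0" "2 * q * \<alpha> \<le> 1" "2 * q * \<beta> \<le> 1" "x \<ge> 0" "y \<ge> 0"
  shows "max (x + y - q) 0 \<le> x + y - q + q * (1 - (\<alpha> * x + \<beta> * y))\<^sup>2"
proof -
  have "2 * q * \<alpha> * x \<le> 1 * x" "2 * q * \<beta> * y \<le> 1 * y"
    using assms by (intro mult_right_mono; simp)+
  moreover have "0 \<le> q * (\<alpha> * x + \<beta> * y)\<^sup>2"
    using assms(1) by simp
  \<comment> \<open>The constants \<open>- q\<close> and \<open>q\<close> cancel, leaving three
    nonnegative terms; hence the majorant dominates \<open>0\<close>. That it dominates
    \<open>x + y - q\<close> is visible from the square.\<close>
  moreover have "x + y - q + q * (1 - (\<alpha> * x + \<beta> * y))\<^sup>2 =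
      (x - 2 * q * \<alpha> * x) + (y - 2 * q * \<beta> * y) + q * (\<alpha> * x + \<beta> * y)\<^sup>2"
    by (simp add: power2_eq_square algebra_simps)
  ultimately have "0 \<le> x + y - q + q * (1 - (\<alpha> * x + \<beta> * y))\<^sup>2"
    by linarith
  moreover have "0 \<le> q * (1 - (\<alpha> * x + \<beta> * y))\<^sup>2"
    using assms(1) by simp
  ultimately show ?thesis by linarith
qed

text \<open>Weak duality: \<alpha> and \<beta> act as dual variables, and since the majorant is
  quadratic, its expectation is the same for every law in the class.\<close>

lemma expected_excess_le:
  fixes q \<alpha> \<beta> :: real
  assumes P: "P \<in> moment_class m1 m2 s1 s2 s12"
    and q: "q \<ge> 0" "2 * q * \<alpha> \<le> 1" "2 * q * \<beta> \<le> 1"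
  shows "expected_excess q P \<le>
    m1 + m2 - q * (2 * \<alpha> * m1 + 2 * \<beta> * m2 - \<alpha>\<^sup>2 * s1 - \<beta>\<^sup>2 * s2 - 2 * \<alpha> * \<beta> * s12)"
proof -
  from P interpret prob_space P by (simp add: moment_class_def)
  let ?g = "\<lambda>x. fst x + snd x - q + q * (1 - (\<alpha> * fst x + \<beta> * snd x))\<^sup>2"
  have nonneg: "AE x in P. 0 \<le> fst x \<and> 0 \<le> snd x"
    and mom: "has_bochner_integral P (\<lambda>x. fst x) m1" "has_bochner_integral P (\<lambda>x. snd x) m2"
      "has_bochner_integral P (\<lambda>x. (fst x)\<^sup>2) s1" "has_bochner_integral P (\<lambda>x. (snd x)\<^sup>2) s2"
      "has_bochner_integral P (\<lambda>x. fst x * snd x) s12"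
    using P by (auto simp: moment_class_def)
  \<comment> \<open>The expanded majorant has no constant term, so it is a linear combination of the
    five functions whose moments are prescribed.\<close>
  have "has_bochner_integral P
     (\<lambda>x. (1 - 2 * q * \<alpha>) * fst x + (1 - 2 * q * \<beta>) * snd x + q * \<alpha>\<^sup>2 * (fst x)\<^sup>2
          + q * \<beta>\<^sup>2 * (snd x)\<^sup>2 + 2 * q * \<alpha> * \<beta> * (fst x * snd x))
     ((1 - 2 * q * \<alpha>) * m1 + (1 - 2 * q * \<beta>) * m2 + q * \<alpha>\<^sup>2 * s1
          + q * \<beta>\<^sup>2 * s2 + 2 * q * \<alpha> * \<beta> * s12)"
    by (intro has_bochner_integral_add has_bochner_integral_mult_right mom)
  then have g: "has_bochner_integral P ?g
    (m1 + m2 - q * (2 * \<alpha> * m1 + 2 * \<beta> * m2 - \<alpha>\<^sup>2 * s1 - \<beta>\<^sup>2 * s2 - 2 * \<alpha> * \<beta> * s12))"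
    by (simp add: power2_eq_square algebra_simps)
  \<comment> \<open>Integrability has to be secured before comparing integrals, because a
    non-integrable function has integral \<open>0\<close> by default.\<close>
  have "integrable P (\<lambda>x. max (fst x + snd x - q) 0)"
    using mom(1,2) by (intro integrable_max) (auto simp: has_bochner_integral_iff)
  then have "expected_excess q P \<le> integral\<^sup>L P ?g"
    unfolding expected_excess_def
    by (rule integral_mono_AE)
       (use g nonneg excess_le_quadratic[OF q] in \<open>auto simp: has_bochner_integral_iff\<close>)
  with g show ?thesis
    by (simp add: has_bochner_integral_integral_eq)
qed

lemma v_P_eqI:
  assumes "P \<in> F" "expected_excess q P = v" "\<And>P'. P' \<in> F \<Longrightarrow> expected_excess q P' \<le> v"
  shows "v_P q F = ereal v"
  unfolding v_P_def using assms by (intro antisym SUP_least SUP_upper2[of P]) auto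

section \<open>Consequences of the hypotheses on the parameters\<close>

lemma moment_det_pos:
  fixes a b c :: real
  assumes "a > 1" "b > 1" "(a - 1) * (b - 1) \<ge> (c - 1)\<^sup>2" and "b > c \<or> a > c"
  shows "a * b - c\<^sup>2 > 0"
proof -
  \<comment> \<open>For the coordinates divided by their means, the left side is the Gram
    determinant, the bracket is the determinant of the covariance matrix, and
    \<open>a + b - 2 * c\<close> is the second moment of the difference.\<close>
  have det: "a * b - c\<^sup>2 = ((a - 1) * (b - 1) - (c - 1)\<^sup>2) + (a + b - 2 * c)"
    by (simp add: power2_eq_square algebra_simps)
  have "a + b - 2 * c > 0"
  proof (rule ccontr)
    assume neg: "\<not> a + b - 2 * c > 0"
    \<comment> \<open>Squaring is monotone here because \<open>a - 1\<close> and
      \<open>b - 1\<close> are positive. Comparison with the covariance condition forces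
      \<open>a = b\<close>, hence both are at most \<open>c\<close>, which is the excluded
      case.\<close>
    have "(a - 1 + (b - 1))\<^sup>2 \<le> (2 * (c - 1))\<^sup>2"
      using neg assms(1,2) by (intro power_mono) auto
    moreover have "(a - 1 + (b - 1))\<^sup>2 = (a - b)\<^sup>2 + 4 * ((a - 1) * (b - 1))"
      by (simp add: power2_eq_square algebra_simps)
    ultimately have "(a - b)\<^sup>2 \<le> 4 * ((c - 1)\<^sup>2 - (a - 1) * (b - 1))"
      by (simp add: power2_eq_square algebra_simps)
    also have "\<dots> \<le> 0"
      using assms(3) by simp
    finally have "(a - b)\<^sup>2 \<le> 0" .
    then have "a = b" by simp
    with neg assms(4) show False by linarith
  qed
  with det assms(3) show ?thesis by linarith
qed

text \<open>Common form of the conditions on \<open>Q_a\<close> and \<open>Q_b\<close>: after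
  squaring, \<open>q\<^sup>2\<close> cancels and the positive factor \<open>m / d\<close> can be
  divided out.\<close>

lemma slope_le_of_le_sqrt:
  fixes q m d k D :: real
  assumes "m > 0" "d > 0" "q > 0"
    and "sqrt (q\<^sup>2 - 2 * q * (k / d) * m + D / d * m\<^sup>2) \<ge> q"
  shows "2 * q * k \<le> D * m"
proof -
  \<comment> \<open>The real \<open>sqrt\<close> is odd and monotone on the whole line, so
    \<open>q > 0\<close> already rules out a negative radicand.\<close>
  have "q\<^sup>2 \<le> q\<^sup>2 - 2 * q * (k / d) * m + D / d * m\<^sup>2"
    using assms(3,4) by (metis less_imp_le real_le_rsqrt real_sqrt_le_iff real_sqrt_abs2 abs_of_pos power2_eq_square)
  then have "0 \<le> (m / d) * (D * m - 2 * q * k)"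
    by (simp add: power2_eq_square algebra_simps)
  with assms(1,2) show ?thesis
    by (simp add: zero_le_mult_iff field_simps)
qed

section \<open>The bound for the given moments and its attainment\<close>

theorem lemmaB2p1:
  fixes \<mu>1 \<mu>2 q a b c :: real
  defines "F \<equiv> moment_class \<mu>1 \<mu>2 (a * \<mu>1\<^sup>2) (b * \<mu>2\<^sup>2) (c * \<mu>1 * \<mu>2)"
  assumes "\<mu>1 > 0" and "\<mu>2 > 0" and "q > 0"
    and "a > 1" and "b > 1" and "c \<ge> 0"
    and "(a - 1) * (b - 1) \<ge> (c - 1)\<^sup>2"
    and "Q_a q \<mu>2 a b c \<ge> q" and "Q_b q \<mu>1 a b c \<ge> q"
  shows "(b > c \<longrightarrow> optimal_distribution q F (discrete_law
            [((0, 0), ((a - 1) * (b - 1) - (c - 1)\<^sup>2) / (a * b - c\<^sup>2)),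
             (((a * b - c\<^sup>2) / (b - c) * \<mu>1, 0), (b - c)\<^sup>2 / ((a * b - c\<^sup>2) * b)),
             ((c * \<mu>1, b * \<mu>2), 1 / b)])) \<and>
         (a > c \<longrightarrow> optimal_distribution q F (discrete_law
            [((0, 0), ((a - 1) * (b - 1) - (c - 1)\<^sup>2) / (a * b - c\<^sup>2)),
             ((0, (a * b - c\<^sup>2) / (a - c) * \<mu>2), (a - c)\<^sup>2 / ((a * b - c\<^sup>2) * a)),
             ((a * \<mu>1, c * \<mu>2), 1 / a)])) \<and>
         (b > c \<or> a > c \<longrightarrow>
            v_P q F = ereal (\<mu>1 + \<mu>2 - q * ((a + b - 2 * c) / (a * b - c\<^sup>2))))"
proof -
  define D where "D = a * b - c\<^sup>2"
  define p where "p = ((a - 1) * (b - 1) - (c - 1)\<^sup>2) / D"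
  define v where "v = \<mu>1 + \<mu>2 - q * ((a + b - 2 * c) / D)"
  note pos = assms(2-7)
  have slope1: "2 * q * (b - c) \<le> D * \<mu>1"
    using assms(10) pos unfolding Q_b_def D_def
    by (intro slope_le_of_le_sqrt[where d = "b - 1"]) auto
  have slope2: "2 * q * (a - c) \<le> D * \<mu>2"
    using assms(9) pos unfolding Q_a_def D_def
    by (intro slope_le_of_le_sqrt[where d = "a - 1"]) auto
  have D: "D > 0" if "b > c \<or> a > c"
    using moment_det_pos[OF pos(4,5) assms(8) that] by (simp add: D_def)
  have upper: "expected_excess q P \<le> v" if "b > c \<or> a > c" "P \<in> F" for P
  proof -
    define \<alpha> where "\<alpha> = (b - c) / (D * \<mu>1)"
    define \<beta> where "\<beta> = (a - c) / (D * \<mu>2)"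
    note D = D[OF that(1)]
    have "2 * q * \<alpha> \<le> 1" "2 * q * \<beta> \<le> 1"
      using slope1 slope2 D pos by (simp_all add: \<alpha>_def \<beta>_def)
    with that(2) pos(3) have "expected_excess q P \<le> \<mu>1 + \<mu>2 - q * (2 * \<alpha> * \<mu>1 + 2 * \<beta> * \<mu>2
        - \<alpha>\<^sup>2 * (a * \<mu>1\<^sup>2) - \<beta>\<^sup>2 * (b * \<mu>2\<^sup>2) - 2 * \<alpha> * \<beta> * (c * \<mu>1 * \<mu>2))"
      unfolding F_def by (intro expected_excess_le) auto
    also have "2 * \<alpha> * \<mu>1 + 2 * \<beta> * \<mu>2 - \<alpha>\<^sup>2 * (a * \<mu>1\<^sup>2) - \<beta>\<^sup>2 * (b * \<mu>2\<^sup>2)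
        - 2 * \<alpha> * \<beta> * (c * \<mu>1 * \<mu>2) = 2 * (\<alpha> * \<mu>1) + 2 * (\<beta> * \<mu>2) - a * (\<alpha> * \<mu>1)\<^sup>2
        - b * (\<beta> * \<mu>2)\<^sup>2 - 2 * c * (\<alpha> * \<mu>1) * (\<beta> * \<mu>2)"
      by (simp add: power2_eq_square algebra_simps)
    also have "\<alpha> * \<mu>1 = (b - c) / D"
      using pos by (simp add: \<alpha>_def)
    also have "\<beta> * \<mu>2 = (a - c) / D"
      using pos by (simp add: \<beta>_def)
    also have "2 * ((b - c) / D) + 2 * ((a - c) / D) - a * ((b - c) / D)\<^sup>2
        - b * ((a - c) / D)\<^sup>2 - 2 * c * ((b - c) / D) * ((a - c) / D) =
        (2 * (a + b - 2 * c) * D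
         - (a * (b - c)\<^sup>2 + b * (a - c)\<^sup>2 + 2 * c * (b - c) * (a - c))) / D\<^sup>2"
      using D by (simp add: field_simps power2_eq_square)
    \<comment> \<open>The matrix with rows \<open>(a, c)\<close> and \<open>(c, b)\<close> maps
      \<open>(b - c, a - c)\<close> to \<open>(D, D)\<close>, so its quadratic form at this vector
      is \<open>D\<close> times the sum of the entries. It cancels half of the linear term.\<close>
    also have "a * (b - c)\<^sup>2 + b * (a - c)\<^sup>2 + 2 * c * (b - c) * (a - c) = (a + b - 2 * c) * D"
      by (simp add: D_def power2_eq_square algebra_simps)
    also have "(2 * (a + b - 2 * c) * D - (a + b - 2 * c) * D) / D\<^sup>2 = (a + b - 2 * c) / D"
      using D by (simp add: field_simps power2_eq_square)
    finally show ?thesis unfolding v_def .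
  qed
  have p: "p \<ge> 0" "1 - p = (a + b - 2 * c) / D" if "b > c \<or> a > c"
    using D[OF that] assms(8) by (simp_all add: p_def D_def field_simps power2_eq_square)
  \<comment> \<open>In units of the means, the last premise is the line \<ell> = 1. Weighting the
    two slope bounds by \<open>x\<close> and \<open>y\<close> shows that on this line within the
    quadrant the coordinate sum is at least \<open>2 * q\<close>, so the positive part is
    inactive.\<close>
  have line: "2 * q \<le> x * \<mu>1 + y * \<mu>2"
    if "b > c \<or> a > c" "x \<ge> 0" "y \<ge> 0" "x * (b - c) + y * (a - c) = D" for x y
  proof -
    have "x * (2 * q * (b - c)) + y * (2 * q * (a - c)) \<le> x * (D * \<mu>1) + y * (D * \<mu>2)"
      using slope1 slope2 that by (intro add_mono mult_left_mono)
    also have "x * (2 * q * (b - c)) + y * (2 * q * (a - c)) = D * (2 * q)"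
      unfolding that(4)[symmetric] by (simp add: algebra_simps)
    also have "x * (D * \<mu>1) + y * (D * \<mu>2) = D * (x * \<mu>1 + y * \<mu>2)"
      by (simp add: algebra_simps)
    finally show ?thesis using D[OF that(1)] by simp
  qed
  \<comment> \<open>Attainment is reduced to conditions free of the means: both outer atoms lie on
    \<ell> = 1, their mass is \<open>1 - p\<close>, and the normalized moments are \<open>1\<close>,
    \<open>1\<close>, \<open>a\<close>, \<open>b\<close>, \<open>c\<close>.\<close>
  have attained: "discrete_law [((0, 0), p), ((u1 * \<mu>1, u2 * \<mu>2), r), ((w1 * \<mu>1, w2 * \<mu>2), s)] \<in> F"
      "expected_excess q (discrete_law
         [((0, 0), p), ((u1 * \<mu>1, u2 * \<mu>2), r), ((w1 * \<mu>1, w2 * \<mu>2), s)]) = v"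
    if "b > c \<or> a > c" "r \<ge> 0" "s \<ge> 0" "r + s = (a + b - 2 * c) / D"
      and "u1 \<ge> 0" "u2 \<ge> 0" "w1 \<ge> 0" "w2 \<ge> 0"
      and "u1 * (b - c) + u2 * (a - c) = D" "w1 * (b - c) + w2 * (a - c) = D"
      and "r * u1 + s * w1 = 1" "r * u2 + s * w2 = 1"
      and "r * u1\<^sup>2 + s * w1\<^sup>2 = a" "r * u2\<^sup>2 + s * w2\<^sup>2 = b"
      and "r * (u1 * u2) + s * (w1 * w2) = c"
    for r s u1 u2 w1 w2
  proof -
    have m: "r * (u1 * \<mu>1) + s * (w1 * \<mu>1) = \<mu>1" "r * (u2 * \<mu>2) + s * (w2 * \<mu>2) = \<mu>2"
      using arg_cong[OF that(11), of "\<lambda>t. t * \<mu>1"] arg_cong[OF that(12), of "\<lambda>t. t * \<mu>2"]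
      by (simp_all add: algebra_simps)
    show "discrete_law [((0, 0), p), ((u1 * \<mu>1, u2 * \<mu>2), r), ((w1 * \<mu>1, w2 * \<mu>2), s)] \<in> F"
      unfolding F_def
    proof (rule three_point_moment_class)
      show "r * (u1 * \<mu>1)\<^sup>2 + s * (w1 * \<mu>1)\<^sup>2 = a * \<mu>1\<^sup>2"
        unfolding that(13)[symmetric] by (simp add: power2_eq_square algebra_simps)
      show "r * (u2 * \<mu>2)\<^sup>2 + s * (w2 * \<mu>2)\<^sup>2 = b * \<mu>2\<^sup>2"
        unfolding that(14)[symmetric] by (simp add: power2_eq_square algebra_simps)
      show "r * (u1 * \<mu>1 * (u2 * \<mu>2)) + s * (w1 * \<mu>1 * (w2 * \<mu>2)) = c * \<mu>1 * \<mu>2"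
        unfolding that(15)[symmetric] by (simp add: power2_eq_square algebra_simps)
    qed (use p that pos m in auto)
    show "expected_excess q (discrete_law
         [((0, 0), p), ((u1 * \<mu>1, u2 * \<mu>2), r), ((w1 * \<mu>1, w2 * \<mu>2), s)]) = v"
      unfolding v_def that(4)[symmetric]
      by (subst three_point_expected_excess)
         (use p[OF that(1)] that(2-4) pos(3) m line[OF that(1,5,6,9)] line[OF that(1,7,8,10)] in auto)
  qed
  have optimal: "v_P q F = ereal v" "optimal_distribution q F P"
    if "b > c \<or> a > c" "P \<in> F" "expected_excess q P = v" for P
    using v_P_eqI[OF that(2,3) upper[OF that(1)]] that(2,3)
    by (auto simp: optimal_distribution_def)
  \<comment> \<open>The middle atom is where \<ell> = 1 meets the first axis. Only the last atom has
    a nonzero second coordinate, so weight \<open>1 / b\<close> at \<open>(c, b)\<close> already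
    yields the normalized moments \<open>1\<close>, \<open>b\<close> and \<open>c\<close> that
    involve it; \<open>eqs\<close> collects the other conditions.\<close>
  have law1: "discrete_law [((0, 0), p), ((D / (b - c) * \<mu>1, 0), (b - c)\<^sup>2 / (D * b)),
        ((c * \<mu>1, b * \<mu>2), 1 / b)] \<in> F"
      "expected_excess q (discrete_law [((0, 0), p),
        ((D / (b - c) * \<mu>1, 0), (b - c)\<^sup>2 / (D * b)), ((c * \<mu>1, b * \<mu>2), 1 / b)]) = v"
    if "b > c"
  proof -
    have bc: "b - c > 0" and D0: "D > 0" using that D by auto
    have eqs: "(b - c)\<^sup>2 / (D * b) + 1 / b = (a + b - 2 * c) / D"
      "c * (b - c) + b * (a - c) = D"
      "(b - c)\<^sup>2 / (D * b) * (D / (b - c)) + 1 / b * c = 1"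
      "(b - c)\<^sup>2 / (D * b) * (D / (b - c))\<^sup>2 + 1 / b * c\<^sup>2 = a"
    proof -
      have "(b - c)\<^sup>2 / (D * b) + 1 / b = ((b - c)\<^sup>2 + D) / (D * b)"
        using D0 pos by (simp add: field_simps)
      also have "(b - c)\<^sup>2 + D = (a + b - 2 * c) * b"
        by (simp add: D_def power2_eq_square algebra_simps)
      finally show "(b - c)\<^sup>2 / (D * b) + 1 / b = (a + b - 2 * c) / D"
        using pos by simp
      show "c * (b - c) + b * (a - c) = D"
        by (simp add: D_def power2_eq_square algebra_simps)
      have "(b - c)\<^sup>2 / (D * b) * (D / (b - c)) = (b - c) / b"
        using D0 bc by (simp add: power2_eq_square)
      then show "(b - c)\<^sup>2 / (D * b) * (D / (b - c)) + 1 / b * c = 1"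
        using pos by (simp add: field_simps)
      have "(b - c)\<^sup>2 / (D * b) * (D / (b - c))\<^sup>2 = D / b"
        using D0 bc by (simp add: power2_eq_square)
      then show "(b - c)\<^sup>2 / (D * b) * (D / (b - c))\<^sup>2 + 1 / b * c\<^sup>2 = a"
        using pos by (simp add: D_def field_simps)
    qed
    show "discrete_law [((0, 0), p), ((D / (b - c) * \<mu>1, 0), (b - c)\<^sup>2 / (D * b)),
        ((c * \<mu>1, b * \<mu>2), 1 / b)] \<in> F"
      "expected_excess q (discrete_law [((0, 0), p),
        ((D / (b - c) * \<mu>1, 0), (b - c)\<^sup>2 / (D * b)), ((c * \<mu>1, b * \<mu>2), 1 / b)]) = v"
      using attained[of "(b - c)\<^sup>2 / (D * b)" "1 / b" "D / (b - c)" 0 c b] eqs bc D0 pos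
      by (simp_all add: power2_eq_square)
  qed
  \<comment> \<open>Mirror image of \<open>law1\<close>: the coordinates are exchanged together with
    \<open>a\<close> and \<open>b\<close>, and the middle atom moves to the second axis.\<close>
  have law2: "discrete_law [((0, 0), p), ((0, D / (a - c) * \<mu>2), (a - c)\<^sup>2 / (D * a)),
        ((a * \<mu>1, c * \<mu>2), 1 / a)] \<in> F"
      "expected_excess q (discrete_law [((0, 0), p),
        ((0, D / (a - c) * \<mu>2), (a - c)\<^sup>2 / (D * a)), ((a * \<mu>1, c * \<mu>2), 1 / a)]) = v"
    if "a > c"
  proof -
    have ac: "a - c > 0" and D0: "D > 0" using that D by auto
    have eqs: "(a - c)\<^sup>2 / (D * a) + 1 / a = (a + b - 2 * c) / D"
      "a * (b - c) + c * (a - c) = D"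
      "(a - c)\<^sup>2 / (D * a) * (D / (a - c)) + 1 / a * c = 1"
      "(a - c)\<^sup>2 / (D * a) * (D / (a - c))\<^sup>2 + 1 / a * c\<^sup>2 = b"
    proof -
      have "(a - c)\<^sup>2 / (D * a) + 1 / a = ((a - c)\<^sup>2 + D) / (D * a)"
        using D0 pos by (simp add: field_simps)
      also have "(a - c)\<^sup>2 + D = (a + b - 2 * c) * a"
        by (simp add: D_def power2_eq_square algebra_simps)
      finally show "(a - c)\<^sup>2 / (D * a) + 1 / a = (a + b - 2 * c) / D"
        using pos by simp
      show "a * (b - c) + c * (a - c) = D"
        by (simp add: D_def power2_eq_square algebra_simps)
      have "(a - c)\<^sup>2 / (D * a) * (D / (a - c)) = (a - c) / a"
        using D0 ac by (simp add: power2_eq_square)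
      then show "(a - c)\<^sup>2 / (D * a) * (D / (a - c)) + 1 / a * c = 1"
        using pos by (simp add: field_simps)
      have "(a - c)\<^sup>2 / (D * a) * (D / (a - c))\<^sup>2 = D / a"
        using D0 ac by (simp add: power2_eq_square)
      then show "(a - c)\<^sup>2 / (D * a) * (D / (a - c))\<^sup>2 + 1 / a * c\<^sup>2 = b"
        using pos by (simp add: D_def field_simps)
    qed
    show "discrete_law [((0, 0), p), ((0, D / (a - c) * \<mu>2), (a - c)\<^sup>2 / (D * a)),
        ((a * \<mu>1, c * \<mu>2), 1 / a)] \<in> F"
      "expected_excess q (discrete_law [((0, 0), p),
        ((0, D / (a - c) * \<mu>2), (a - c)\<^sup>2 / (D * a)), ((a * \<mu>1, c * \<mu>2), 1 / a)]) = v"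
      using attained[of "(a - c)\<^sup>2 / (D * a)" "1 / a" 0 "D / (a - c)" a c] eqs ac D0 pos
      by (simp_all add: power2_eq_square)
  qed
  show ?thesis
    using optimal law1 law2 unfolding D_def p_def v_def by blast
qed

end
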